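(* Let $\mathcal{F}$ be a forbidden family and let $k,d\in\mathbb{N}$. Let $G_1,G_2,\dots,G_d$ be graphs, each with $\mathcal{F}$-free chromatic span $\Lambda(G_i,\mathcal{F})\leq k$ (which is implied if $\chi(G_i,\mathcal{F})\leq k+1$). Then $$\Lambda(G_1\,\square\,G_2\,\square\cdots\square\,G_d,\mathcal{F})\leq k(kd-k+1)\quad\text{and}\quad \chi(G_1\,\square\,G_2\,\square\cdots\square\,G_d,\mathcal{F})\leq 2k(kd-k+1)+1.$$ Moreover, for all $\epsilon>0$ and for large $d>d(k,\epsilon)$, $$\Lambda(G_1\,\square\,G_2\,\square\cdots\square\,G_d,\mathcal{F})\leq \frac{e^{\gamma}}{1-\epsilon}\,dk\log k\quad\text{and}\quad \chi(G_1\,\square\,G_2\,\square\cdots\square\,G_d,\mathcal{F})\leq 1+\frac{2e^{\gamma}}{1-\epsilon}\,dk\log k.$$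
   Context: All graphs are finite, simple and undirected. $\mathbb{N}=\{1,2,\dots\}$, $\gamma=0.5772\ldots$ is Euler's constant, and $\log$ is the natural logarithm. A colouring of a graph $G$ is a function $c:V(G)\to\mathbb{Z}$ with $c(v)\neq c(w)$ for every edge $vw\in E(G)$; it is a $k$-colouring if it takes at most $k$ distinct values. The span of $c$ is $\max\{|c(v)-c(w)|:vw\in E(G)\}$ (taken to be $0$ if $G$ has no edges). A forbidden family $\mathcal{F}$ is a family of connected bipartite graphs, each with at least three vertices. A colouring $c$ of $G$ is $\mathcal{F}$-free if $|\{c(v):v\in V(H)\}|\geq 3$ for every subgraph $H$ of $G$ that is isomorphic to a graph in $\mathcal{F}$. The $\mathcal{F}$-free chromatic number $\chi(G,\mathcal{F})$ is the minimum integer $k$ such that $G$ has an $\mathcal{F}$-free $k$-colouring. The $\mathcal{F}$-free chromatic span $\Lambda(G,\mathcal{F})$ is the minimum integer $k$ such that $G$ has an $\mathcal{F}$-free colouring with span $k$. The cartesian product $G_1\,\square\,G_2\,\square\cdots\square\,G_d$ has vertex set $V(G_1)\times\cdots\times V(G_d)$, where $(v_1,\dots,v_d)$ and $(w_1,\dots,w_d)$ are adjacent if and only if $v_iw_i\in E(G_i)$ for some $i$ and $v_j=w_j$ for all $j\neq i$. Here $d(k,\epsilon)$ denotes a threshold depending on $k$ and $\epsilon$.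
   Formalization: The asymptotic bounds are stated only for ε < 1 and k ≥ 2: for ε = 1 the bound is undefined, for ε > 1 and k ≥ 2 it is negative, and for k = 1 it reads Λ ≤ 0, which is false for hypercubes (all G_i = K_2). *)

theory Defs
  imports "HOL-Analysis.Harmonic_Numbers" "Graph_Theory.Graph_Theory"
begin

text \<open>
  Finite simple undirected graphs are the \<^locale>\<open>pair_graph\<close>s of the Graph Theory entry: every
  edge \<open>vw\<close> is represented by the two arcs \<open>(v, w)\<close> and \<open>(w, v)\<close>.
  A subgraph in the undirected sense is therefore a \<^const>\<open>subgraph\<close> that is itself a
  \<^locale>\<open>pair_graph\<close>.  The name \<open>connected\<close> is qualified because of its topological homonym.
\<close>

definition bipartite_graph :: "'a pair_pre_digraph \<Rightarrow> bool" where
  "bipartite_graph G \<longleftrightarrow>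
     (\<exists>A B. A \<union> B = pverts G \<and> A \<inter> B = {} \<and> parcs G \<subseteq> A \<times> B \<union> B \<times> A)"

definition forbidden_family :: "'b pair_pre_digraph set \<Rightarrow> bool" where
  "forbidden_family F \<longleftrightarrow>
     (\<forall>H\<in>F. pair_graph H \<and> Digraph_Component.connected (with_proj H) \<and>
            bipartite_graph H \<and> 3 \<le> card (pverts H))"

text \<open>Colourings are total functions; their values outside \<^term>\<open>pverts G\<close> are irrelevant.\<close>

definition colouring :: "'a pair_pre_digraph \<Rightarrow> ('a \<Rightarrow> int) \<Rightarrow> bool" where
  "colouring G c \<longleftrightarrow> (\<forall>(v, w)\<in>parcs G. c v \<noteq> c w)"

definition colouring_span :: "'a pair_pre_digraph \<Rightarrow> ('a \<Rightarrow> int) \<Rightarrow> int" where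
  "colouring_span G c =
     (if parcs G = {} then 0 else Max ((\<lambda>(v, w). \<bar>c v - c w\<bar>) ` parcs G))"

definition free_colouring ::
    "'b pair_pre_digraph set \<Rightarrow> 'a pair_pre_digraph \<Rightarrow> ('a \<Rightarrow> int) \<Rightarrow> bool" where
  "free_colouring F G c \<longleftrightarrow> colouring G c \<and>
     (\<forall>H. pair_graph H \<and> subgraph (with_proj H) (with_proj G) \<and>
          (\<exists>J\<in>F. digraph_iso (with_proj H) (with_proj J)) \<longrightarrow>
          3 \<le> card (c ` pverts H))"

definition free_chromatic_number ::
    "'a pair_pre_digraph \<Rightarrow> 'b pair_pre_digraph set \<Rightarrow> nat" where
  "free_chromatic_number G F =
     (LEAST k. \<exists>c. free_colouring F G c \<and> card (c ` pverts G) \<le> k)"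

definition free_chromatic_span ::
    "'a pair_pre_digraph \<Rightarrow> 'b pair_pre_digraph set \<Rightarrow> nat" where
  "free_chromatic_span G F =
     (LEAST k. \<exists>c. free_colouring F G c \<and> colouring_span G c = int k)"

definition cartesian_product ::
    "'i set \<Rightarrow> ('i \<Rightarrow> 'a pair_pre_digraph) \<Rightarrow> ('i \<Rightarrow> 'a) pair_pre_digraph" where
  "cartesian_product I G =
     \<lparr> pverts = (\<Pi>\<^sub>E i\<in>I. pverts (G i)),
       parcs = {(v, w). v \<in> (\<Pi>\<^sub>E i\<in>I. pverts (G i)) \<and> w \<in> (\<Pi>\<^sub>E i\<in>I. pverts (G i)) \<and>
                  (\<exists>i\<in>I. (v i, w i) \<in> parcs (G i) \<and> (\<forall>j\<in>I - {i}. v j = w j))} \<rparr>"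

text \<open>
  An injective colouring is free with respect to any forbidden family, so both minima above are
  attained.
\<close>

lemma free_colouring_exists:
  assumes F: "forbidden_family F" and G: "pair_graph G"
  shows "\<exists>c. free_colouring F G c"
proof -
  interpret G: pair_graph G by (rule G)
  obtain f :: "_ \<Rightarrow> nat" where f: "inj_on f (pverts G)"
    using finite_imp_inj_to_nat_seg[OF G.pair_finite_verts] by blast
  let ?c = "\<lambda>v. int (f v)"
  have inj: "inj_on ?c (pverts G)"
    using f by (auto simp: inj_on_def)
  have "colouring G ?c"
    unfolding colouring_def
  proof (clarify)
    fix v w assume vw: "(v, w) \<in> parcs G" and eq: "?c v = ?c w"
    have "v \<in> pverts G" "w \<in> pverts G" "v \<noteq> w"
      using G.arc_fst_in_verts[OF vw] G.arc_snd_in_verts[OF vw] G.pair_no_loops[OF vw] by auto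
    with inj eq show False by (metis inj_onD)
  qed
  moreover have "3 \<le> card (?c ` pverts H)"
    if H: "subgraph (with_proj H) (with_proj G)" "J \<in> F"
       "digraph_iso (with_proj H) (with_proj J)" for H J
  proof -
    have "pverts H \<subseteq> pverts G" using H(1) by (auto simp: subgraph_def)
    hence "card (?c ` pverts H) = card (pverts H)"
      by (intro card_image inj_on_subset[OF inj])
    moreover have "card (pverts J) = card (pverts H)"
    proof -
      obtain h where h: "pre_digraph.digraph_isomorphism (with_proj H) h"
          "with_proj J = app_iso h (with_proj H)"
        using H(3) by (auto simp: digraph_iso_def)
      have "pverts J = iso_verts h ` pverts H"
        using arg_cong[OF h(2), of verts] by (simp add: verts_app_iso)
      moreover have "inj_on (iso_verts h) (pverts H)"
        using h(1) by (simp add: pre_digraph.digraph_isomorphism_def)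
      ultimately show ?thesis by (simp add: card_image)
    qed
    ultimately show ?thesis using F H(2) by (fastforce simp: forbidden_family_def)
  qed
  ultimately show ?thesis unfolding free_colouring_def by blast
qed

lemma free_chromatic_number_attained:
  assumes "forbidden_family F" "pair_graph G"
  shows "\<exists>c. free_colouring F G c \<and> card (c ` pverts G) \<le> free_chromatic_number G F"
  unfolding free_chromatic_number_def
  by (rule LeastI_ex) (use free_colouring_exists[OF assms] in blast)

lemma free_chromatic_span_attained:
  assumes "forbidden_family F" "pair_graph G"
  shows "\<exists>c. free_colouring F G c \<and> colouring_span G c = int (free_chromatic_span G F)"
  unfolding free_chromatic_span_def
proof (rule LeastI_ex)
  obtain c where c: "free_colouring F G c" using free_colouring_exists[OF assms] by blast
  have "finite (parcs G)" using assms(2) by (simp add: pair_graph_def pair_digraph_def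
    pair_fin_digraph_def pair_fin_digraph_axioms_def)
  hence "0 \<le> colouring_span G c"
    unfolding colouring_span_def by (fastforce simp: Max_ge_iff)
  with c show "\<exists>k c. free_colouring F G c \<and> colouring_span G c = int k"
    by (metis nonneg_int_cases)
qed

end

theory Submission
  imports Defs
begin

text \<open>
  Given free colourings \<open>c i\<close> of the factors with span at most \<open>k\<close>, colour a vertex \<open>v\<close> of the product
  by \<open>C (\<lambda>i. c i (v i))\<close>, where \<open>C\<close> is an integer function on \<open>\<int>\<^sup>d\<close> that separates a point from all
  points reached by changing one coordinate by at most \<open>k\<close>, and these points from each other.
  Then two equally coloured neighbours of a vertex lie in the same direction and agree under the
  colouring of that factor.  So a bichromatic connected subgraph lies in one fibre and projects to
  a bichromatic copy in a factor.

  All functions \<open>C\<close> used have the form \<open>M * (\<Sum>i. h i * x i) + (\<Sum>i. b i * x i) mod M\<close>.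
  For \<open>M = 1\<close> the \<open>h i\<close> must form a multiplicative Sidon set, and \<open>h i = k (i - 1) + 1\<close> yields the first two
  bounds.  For the asymptotic bounds no prime number estimates are needed: \<open>h i = 1\<close>, \<open>b i = i\<close> and
  \<open>M \<approx> d\<close> coprime to \<open>fact k\<close> give span about \<open>(k + 1) d\<close>, which is below \<open>e\<^sup>\<gamma> d k ln k\<close> for
  \<open>k \<ge> 3\<close>, and a denser packing handles \<open>k = 2\<close>.
\<close>

section \<open>Finite simple graphs and induction over connected graphs\<close>

lemma pair_graph_sym: "pair_graph G \<Longrightarrow> (v, w) \<in> parcs G \<Longrightarrow> (w, v) \<in> parcs G"
  by (rule pair_sym_digraph.arcs_symmetric)
    (simp_all add: pair_graph_def pair_pseudo_graph_def)

lemma pair_graph_arcD: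
  assumes "pair_graph G" "(v, w) \<in> parcs G"
  shows "v \<in> pverts G" "w \<in> pverts G" "v \<noteq> w"
proof -
  interpret pair_graph G by fact
  show "v \<in> pverts G" "w \<in> pverts G" "v \<noteq> w"
    using arc_fst_in_verts[OF assms(2)] arc_snd_in_verts[OF assms(2)] pair_no_loops[OF assms(2)]
    by auto
qed

lemma pair_graph_finite:
  assumes "pair_graph G"
  shows "finite (pverts G)" "finite (parcs G)"
proof -
  interpret pair_graph G by fact
  show "finite (pverts G)" "finite (parcs G)"
    by (rule pair_finite_verts, rule pair_finite_arcs)
qed

lemma pair_graphI:
  assumes "finite (pverts G)" "\<And>v w. (v, w) \<in> parcs G \<Longrightarrow> v \<in> pverts G \<and> w \<in> pverts G \<and> v \<noteq> w"
    and "\<And>v w. (v, w) \<in> parcs G \<Longrightarrow> (w, v) \<in> parcs G"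
  shows "pair_graph G"
proof -
  have "parcs G \<subseteq> pverts G \<times> pverts G" using assms(2) by auto
  hence "finite (parcs G)" by (rule finite_subset) (simp add: assms(1))
  thus ?thesis
    using assms by unfold_locales (auto simp: symmetric_def sym_def)
qed

text \<open>Connectedness of digraphs is weak; symmetry of the arcs upgrades it to directed
  reachability, along which \<open>P\<close> spreads.\<close>

lemma connected_induct:
  assumes H: "pair_graph H" and conn: "Digraph_Component.connected (with_proj H)"
    and v: "v \<in> pverts H" "P v" and u: "u \<in> pverts H"
    and step: "\<And>x y. (x, y) \<in> parcs H \<Longrightarrow> P x \<Longrightarrow> P y"
  shows "P u"
proof -
  interpret pair_graph H by fact
  have "strongly_connected (with_proj H)"
    using symmetric_connected_imp_strongly_connected[OF pair_sym_arcs conn] .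
  hence "v \<rightarrow>\<^sup>*\<^bsub>with_proj H\<^esub> u" using v u by (auto simp: strongly_connected_def)
  hence "(v, u) \<in> rtrancl_on (pverts H) (parcs H)" by (simp add: reachable_def)
  thus ?thesis by (induction rule: rtrancl_on_induct) (use v step in auto)
qed

lemma connected_ex_arc:
  assumes H: "pair_graph H" "Digraph_Component.connected (with_proj H)"
    and card: "2 \<le> card (pverts H)" and v: "v \<in> pverts H"
  shows "\<exists>w. (v, w) \<in> parcs H"
proof (rule ccontr)
  assume no: "\<nexists>w. (v, w) \<in> parcs H"
  have "u = v" if "u \<in> pverts H" for u
    using connected_induct[OF H v, of "\<lambda>x. x = v"] no that by auto
  hence "pverts H \<subseteq> {v}" by auto
  from card_mono[OF _ this] card show False by simp
qed

section \<open>Bichromatic connected graphs and a local form of freeness\<close>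

lemma card_le_two_eq:
  assumes "finite A" "card A \<le> 2" "a \<in> A" "b \<in> A" "c \<in> A" "a \<noteq> b" "a \<noteq> c"
  shows "b = c"
proof (rule ccontr)
  assume "b \<noteq> c"
  hence "card {a, b, c} = 3" using assms by simp
  moreover have "card {a, b, c} \<le> card A" using assms by (intro card_mono) auto
  ultimately show False using assms by simp
qed

text \<open>If the neighbours of each vertex share one value, the values alternate along every walk,
  so a single arc already shows them all. The invariant \<open>P\<close> also records the
  neighbours' value, since the value of \<open>x\<close> alone does not determine the next
  one.\<close>

lemma card_image_le_two_connected:
  assumes H: "pair_graph H" "Digraph_Component.connected (with_proj H)"
    and card: "2 \<le> card (pverts H)"
    and g: "\<And>x y z. (x, y) \<in> parcs H \<Longrightarrow> (x, z) \<in> parcs H \<Longrightarrow> g y = g z"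
  shows "card (g ` pverts H) \<le> 2"
proof -
  have "pverts H \<noteq> {}" using card by auto
  then obtain v where v: "v \<in> pverts H" by auto
  obtain w where w: "(v, w) \<in> parcs H" using connected_ex_arc[OF H card v] by auto
  define P where "P = (\<lambda>x. (g x = g v \<and> (\<forall>y. (x, y) \<in> parcs H \<longrightarrow> g y = g w)) \<or>
                          (g x = g w \<and> (\<forall>y. (x, y) \<in> parcs H \<longrightarrow> g y = g v)))"
  have "P v" using g[OF w] by (metis P_def)
  moreover have "P y" if "(x, y) \<in> parcs H" "P x" for x y
    using that g[OF pair_graph_sym[OF H(1) that(1)]] unfolding P_def by metis
  ultimately have "P u" if "u \<in> pverts H" for u
    using connected_induct[OF H v _ that, of P] by blast
  hence "g ` pverts H \<subseteq> {g v, g w}" unfolding P_def by blast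
  hence "card (g ` pverts H) \<le> card {g v, g w}" by (rule card_mono[rotated]) simp
  also have "\<dots> \<le> 2" by (simp add: card_insert_le_m1)
  finally show ?thesis .
qed

lemma forbidden_copy:
  assumes F: "forbidden_family F" "J \<in> F" and H: "pair_graph H"
    and iso: "digraph_iso (with_proj H) (with_proj J)"
  shows "Digraph_Component.connected (with_proj H)" "3 \<le> card (pverts H)"
proof -
  have J: "pair_graph J" "Digraph_Component.connected (with_proj J)" "3 \<le> card (pverts J)"
    using F by (auto simp: forbidden_family_def)
  interpret J: pair_graph J by (rule J)
  interpret H: pair_graph H by (rule H)
  \<comment> \<open>The isomorphism is reversed because connectedness is known for \<open>J\<close>
    and passes from source to image.\<close>
  have "digraph_iso (with_proj J) (with_proj H)"
    using digraph_iso_swap[OF H.wf_digraph_axioms iso] .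
  then obtain h where h: "pre_digraph.digraph_isomorphism (with_proj J) h"
      "with_proj H = app_iso h (with_proj J)"
    by (auto simp: digraph_iso_def)
  show "Digraph_Component.connected (with_proj H)"
    unfolding h(2) using J.connectedI_app_iso[OF J(2) h(1)] .
  have "pverts H = iso_verts h ` pverts J"
    using arg_cong[OF h(2), of verts] by simp
  moreover have "inj_on (iso_verts h) (pverts J)"
    using h(1) by (simp add: pre_digraph.digraph_isomorphism_def)
  ultimately show "3 \<le> card (pverts H)" using J(3) by (simp add: card_image)
qed

text \<open>On a bichromatic copy all neighbours of a vertex take the one colour other than its own.
  Together with the converse \<open>free_colouring_tricolour\<close>, this replaces counting colours
  by a condition on pairs of neighbours, which is easy to carry over to new colourings.\<close>

lemma free_colouringI:
  assumes F: "forbidden_family F"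
    and col: "colouring G c"
    and free: "\<And>H J. pair_graph H \<Longrightarrow> subgraph (with_proj H) (with_proj G) \<Longrightarrow> J \<in> F \<Longrightarrow>
      digraph_iso (with_proj H) (with_proj J) \<Longrightarrow> Digraph_Component.connected (with_proj H) \<Longrightarrow>
      3 \<le> card (pverts H) \<Longrightarrow>
      (\<And>x y z. (x, y) \<in> parcs H \<Longrightarrow> (x, z) \<in> parcs H \<Longrightarrow> c y = c z) \<Longrightarrow> False"
  shows "free_colouring F G c"
proof -
  have "3 \<le> card (c ` pverts H)"
    if H: "pair_graph H" "subgraph (with_proj H) (with_proj G)" "J \<in> F"
       "digraph_iso (with_proj H) (with_proj J)" for H J
  proof (rule ccontr)
    assume "\<not> 3 \<le> card (c ` pverts H)"
    hence le: "card (c ` pverts H) \<le> 2" by simp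
    have sub: "parcs H \<subseteq> parcs G" using H(2) by (auto simp: subgraph_def)
    have "c y = c z" if xyz: "(x, y) \<in> parcs H" "(x, z) \<in> parcs H" for x y z
    proof (rule card_le_two_eq[OF _ le])
      show "finite (c ` pverts H)" using pair_graph_finite[OF H(1)] by simp
      show "c x \<in> c ` pverts H" "c y \<in> c ` pverts H" "c z \<in> c ` pverts H"
        using pair_graph_arcD[OF H(1)] xyz by auto
      show "c x \<noteq> c y" "c x \<noteq> c z" using xyz sub col by (auto simp: colouring_def)
    qed
    from free[OF H forbidden_copy[OF F H(3,1,4)] this] show False .
  qed
  thus ?thesis using col unfolding free_colouring_def by blast
qed

lemma free_colouring_tricolour:
  assumes "free_colouring F G c" "pair_graph H" "subgraph (with_proj H) (with_proj G)" "J \<in> F"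
    "digraph_iso (with_proj H) (with_proj J)"
    and "Digraph_Component.connected (with_proj H)" "2 \<le> card (pverts H)"
  shows "\<exists>x y z. (x, y) \<in> parcs H \<and> (x, z) \<in> parcs H \<and> c y \<noteq> c z"
proof (rule ccontr)
  assume "\<not> ?thesis"
  hence "card (c ` pverts H) \<le> 2"
    using assms(2,6,7) by (intro card_image_le_two_connected) blast+
  moreover have "3 \<le> card (c ` pverts H)"
    using assms unfolding free_colouring_def by blast
  ultimately show False by simp
qed

section \<open>Span against number of colours\<close>

text \<open>The bound \<open>0 \<le> s\<close> covers edgeless graphs: their span is 0 by
  convention, while the condition on arcs is vacuous.\<close>

lemma colouring_span_le_iff:
  assumes "pair_graph G" "0 \<le> s"
  shows "colouring_span G c \<le> s \<longleftrightarrow> (\<forall>(v, w)\<in>parcs G. \<bar>c v - c w\<bar> \<le> s)"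
  using assms pair_graph_finite(2)[OF assms(1)] by (auto simp: colouring_span_def)

lemma colouring_span_nonneg:
  assumes "pair_graph G"
  shows "0 \<le> colouring_span G c"
  using pair_graph_finite(2)[OF assms] by (fastforce simp: colouring_span_def Max_ge_iff)

lemma free_chromatic_span_le:
  assumes "pair_graph G" "free_colouring F G c" "colouring_span G c \<le> s"
  shows "int (free_chromatic_span G F) \<le> s"
proof -
  have "free_chromatic_span G F \<le> nat (colouring_span G c)"
    unfolding free_chromatic_span_def
    using assms(2) colouring_span_nonneg[OF assms(1)] by (intro Least_le) auto
  thus ?thesis using assms colouring_span_nonneg[OF assms(1), of c] by linarith
qed

text \<open>Reducing a colouring of span \<open>s\<close> modulo \<open>2 s + 1\<close> keeps any two neighbours of a common vertex
  apart, because their colours differ by at most \<open>2 s\<close>.\<close>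

lemma free_chromatic_number_le_span:
  assumes F: "forbidden_family F" and G: "pair_graph G"
  shows "free_chromatic_number G F \<le> 2 * free_chromatic_span G F + 1"
proof -
  obtain c where c: "free_colouring F G c" "colouring_span G c = int (free_chromatic_span G F)"
    using free_chromatic_span_attained[OF F G] by blast
  define s where "s = int (free_chromatic_span G F)"
  define c' where "c' = (\<lambda>v. c v mod (2 * s + 1))"
  have s: "0 \<le> s" by (simp add: s_def)
  have col: "colouring G c" using c(1) by (simp add: free_colouring_def)
  have span: "\<bar>c v - c w\<bar> \<le> s" if "(v, w) \<in> parcs G" for v w
    using colouring_span_le_iff[OF G s, of c] c(2) that by (auto simp: s_def)
  have modD: "c v = c w" if "c' v = c' w" "\<bar>c v - c w\<bar> \<le> 2 * s" for v w
  proof -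
    have "(2 * s + 1) dvd (c v - c w)" using that(1) by (simp add: c'_def mod_eq_dvd_iff)
    hence "c v - c w = 0" using that(2) dvd_imp_le_int[of "c v - c w" "2 * s + 1"] s by linarith
    thus ?thesis by simp
  qed
  have "free_colouring F G c'"
  proof (rule free_colouringI[OF F])
    show "colouring G c'"
      unfolding colouring_def
    proof (clarify)
      fix v w assume vw: "(v, w) \<in> parcs G" "c' v = c' w"
      with modD[OF vw(2)] span[OF vw(1)] s have "c v = c w" by linarith
      thus False using col vw(1) by (auto simp: colouring_def)
    qed
  next
    fix H J
    assume H: "pair_graph H" "subgraph (with_proj H) (with_proj G)" "J \<in> F"
      "digraph_iso (with_proj H) (with_proj J)" "Digraph_Component.connected (with_proj H)"
      "3 \<le> card (pverts H)"
      and eq: "\<And>x y z. (x, y) \<in> parcs H \<Longrightarrow> (x, z) \<in> parcs H \<Longrightarrow> c' y = c' z"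
    obtain x y z where xyz: "(x, y) \<in> parcs H" "(x, z) \<in> parcs H" "c y \<noteq> c z"
      using free_colouring_tricolour[OF c(1) H(1-5)] H(6) by auto
    have "(x, y) \<in> parcs G" "(x, z) \<in> parcs G" using xyz H(2) by (auto simp: subgraph_def)
    from span[OF this(1)] span[OF this(2)] have "\<bar>c y - c z\<bar> \<le> 2 * s" by linarith
    with modD[OF eq[OF xyz(1,2)]] xyz(3) show False by blast
  qed
  moreover have "card (c' ` pverts G) \<le> 2 * free_chromatic_span G F + 1"
  proof -
    have "c' ` pverts G \<subseteq> {0..2 * s}"
      using s by (auto simp: c'_def) (smt (verit) pos_mod_bound)
    hence "card (c' ` pverts G) \<le> card {0..2 * s}" by (intro card_mono) auto
    also have "\<dots> = 2 * free_chromatic_span G F + 1" using s by (simp add: s_def)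
    finally show ?thesis .
  qed
  ultimately show ?thesis unfolding free_chromatic_number_def by (intro Least_le) blast
qed

text \<open>Numbering the used colours from 0 to at most \<open>k\<close> is injective on them, so
  freeness survives, and no two labels differ by more than \<open>k\<close>.\<close>

lemma free_chromatic_span_le_number:
  assumes F: "forbidden_family F" and G: "pair_graph G"
    and k: "free_chromatic_number G F \<le> k + 1"
  shows "free_chromatic_span G F \<le> k"
proof -
  obtain c where c: "free_colouring F G c" "card (c ` pverts G) \<le> k + 1"
    using free_chromatic_number_attained[OF F G] k by (meson le_trans)
  have fin: "finite (c ` pverts G)" using pair_graph_finite[OF G] by simp
  obtain r where r: "bij_betw r (c ` pverts G) {0..<card (c ` pverts G)}"
    using ex_bij_betw_finite_nat[OF fin] by blast
  define c' where "c' = (\<lambda>v. int (r (c v)))"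
  have bound: "c' v \<in> {0..int k}" if "v \<in> pverts G" for v
  proof -
    have "r (c v) \<in> {0..<card (c ` pverts G)}" using r that by (auto simp: bij_betw_def)
    thus ?thesis using c(2) by (auto simp: c'_def)
  qed
  have eqD: "c v = c w" if "v \<in> pverts G" "w \<in> pverts G" "c' v = c' w" for v w
    using that r by (auto simp: c'_def bij_betw_def dest: inj_onD)
  have "free_colouring F G c'"
  proof (rule free_colouringI[OF F])
    show "colouring G c'"
      unfolding colouring_def
    proof (clarify)
      fix v w assume "(v, w) \<in> parcs G" "c' v = c' w"
      with eqD[of v w] pair_graph_arcD[OF G] c(1) show False
        by (auto simp: colouring_def free_colouring_def)
    qed
  next
    fix H J
    assume H: "pair_graph H" "subgraph (with_proj H) (with_proj G)" "J \<in> F"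
      "digraph_iso (with_proj H) (with_proj J)" "Digraph_Component.connected (with_proj H)"
      "3 \<le> card (pverts H)"
      and eq: "\<And>x y z. (x, y) \<in> parcs H \<Longrightarrow> (x, z) \<in> parcs H \<Longrightarrow> c' y = c' z"
    obtain x y z where xyz: "(x, y) \<in> parcs H" "(x, z) \<in> parcs H" "c y \<noteq> c z"
      using free_colouring_tricolour[OF c(1) H(1-5)] H(6) by auto
    have "y \<in> pverts G" "z \<in> pverts G"
      using xyz H(2) pair_graph_arcD[OF H(1)] by (auto simp: subgraph_def)
    from eqD[OF this eq[OF xyz(1,2)]] xyz(3) show False by blast
  qed
  moreover have "colouring_span G c' \<le> int k"
    unfolding colouring_span_le_iff[OF G of_nat_0_le_iff]
  proof (clarify)
    fix v w assume "(v, w) \<in> parcs G"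
    with bound[of v] bound[of w] pair_graph_arcD[OF G] show "\<bar>c' v - c' w\<bar> \<le> int k"
      by fastforce
  qed
  ultimately have "int (free_chromatic_span G F) \<le> int k"
    using free_chromatic_span_le[OF G] by blast
  thus ?thesis by simp
qed

section \<open>Lifting factor colourings to the cartesian product\<close>

lemma cartesian_product_simps:
  "pverts (cartesian_product I G) = (\<Pi>\<^sub>E i\<in>I. pverts (G i))"
  "(v, w) \<in> parcs (cartesian_product I G) \<longleftrightarrow>
     v \<in> (\<Pi>\<^sub>E i\<in>I. pverts (G i)) \<and> w \<in> (\<Pi>\<^sub>E i\<in>I. pverts (G i)) \<and>
     (\<exists>i\<in>I. (v i, w i) \<in> parcs (G i) \<and> (\<forall>j\<in>I - {i}. v j = w j))"
  by (auto simp: cartesian_product_def)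

lemma pair_graph_cartesian_product:
  assumes I: "finite I" and G: "\<And>i. i \<in> I \<Longrightarrow> pair_graph (G i)"
  shows "pair_graph (cartesian_product I G)"
proof (rule pair_graphI)
  show "finite (pverts (cartesian_product I G))"
    unfolding cartesian_product_simps
    using I pair_graph_finite(1)[OF G] by (intro finite_PiE) auto
next
  fix v w assume vw: "(v, w) \<in> parcs (cartesian_product I G)"
  thus "v \<in> pverts (cartesian_product I G) \<and> w \<in> pverts (cartesian_product I G) \<and> v \<noteq> w"
    using pair_graph_arcD(3)[OF G] unfolding cartesian_product_simps by blast
  show "(w, v) \<in> parcs (cartesian_product I G)"
    using vw pair_graph_sym[OF G] unfolding cartesian_product_simps by metis
qed

text \<open>Join integer points that differ in one coordinate of \<open>I\<close>, by at most
  \<open>k\<close>. Then \<open>C\<close> properly colours the square of this graph, while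
  \<open>s\<close> bounds the differences only along the edges of the graph itself.\<close>

definition universal_colouring :: "'i set \<Rightarrow> int \<Rightarrow> int \<Rightarrow> (('i \<Rightarrow> int) \<Rightarrow> int) \<Rightarrow> bool" where
  "universal_colouring I k s C \<longleftrightarrow>
     (\<forall>x. \<forall>i\<in>I. \<forall>j. j \<noteq> 0 \<and> \<bar>j\<bar> \<le> k \<longrightarrow>
        C (x(i := x i + j)) \<noteq> C x \<and> \<bar>C (x(i := x i + j)) - C x\<bar> \<le> s \<and>
        (\<forall>i'\<in>I. \<forall>j'. j' \<noteq> 0 \<and> \<bar>j'\<bar> \<le> k \<and>
           C (x(i := x i + j)) = C (x(i' := x i' + j')) \<longrightarrow> i = i' \<and> j = j'))"

lemma free_colouring_cartesian_product:
  assumes F: "forbidden_family F" and I: "finite I"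
    and G: "\<And>i. i \<in> I \<Longrightarrow> pair_graph (G i)"
    and c: "\<And>i. i \<in> I \<Longrightarrow> free_colouring F (G i) (c i)"
    and span: "\<And>i. i \<in> I \<Longrightarrow> colouring_span (G i) (c i) \<le> k"
    and C: "universal_colouring I k s C" and s: "0 \<le> s"
  shows "\<exists>f. free_colouring F (cartesian_product I G) f \<and>
             colouring_span (cartesian_product I G) f \<le> s"
proof -
  let ?P = "cartesian_product I G"
  \<comment> \<open>The default 0 outside \<open>I\<close> makes \<open>X v\<close> and
    \<open>X w\<close> agree there, so an arc of the product becomes a single function
    update.\<close>
  define X where "X = (\<lambda>v i. if i \<in> I then c i (v i) else 0)"
  define along where "along = (\<lambda>i v w. i \<in> I \<and> (v i, w i) \<in> parcs (G i) \<and> (\<forall>j\<in>I - {i}. v j = w j))"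
  have P: "pair_graph ?P" by (intro pair_graph_cartesian_product I G)
  have arc_along: "\<exists>i. along i v w" if "(v, w) \<in> parcs ?P" for v w
    using that unfolding cartesian_product_simps along_def by blast
  have along_sym: "along i w v" if "along i v w" for i v w
    using that pair_graph_sym[OF G] by (auto simp: along_def)
  have X_along: "X w = (X v)(i := X v i + (c i (w i) - c i (v i)))" if "along i v w" for i v w
    using that by (auto simp: X_def along_def fun_eq_iff)
  have step: "c i (w i) - c i (v i) \<noteq> 0" "\<bar>c i (w i) - c i (v i)\<bar> \<le> k" if "along i v w" for i v w
  proof -
    have i: "i \<in> I" "(v i, w i) \<in> parcs (G i)" using that by (auto simp: along_def)
    show "c i (w i) - c i (v i) \<noteq> 0"
      using c[OF i(1)] i(2) by (auto simp: free_colouring_def colouring_def)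
    have "0 \<le> k" using colouring_span_nonneg[OF G[OF i(1)], of "c i"] span[OF i(1)] by linarith
    from span[OF i(1)] i(2) have "\<bar>c i (v i) - c i (w i)\<bar> \<le> k"
      unfolding colouring_span_le_iff[OF G[OF i(1)] \<open>0 \<le> k\<close>] by auto
    thus "\<bar>c i (w i) - c i (v i)\<bar> \<le> k" by (simp add: abs_minus_commute)
  qed
  define f where "f = (\<lambda>v. C (X v))"
  have neq: "f w \<noteq> f v" and le: "\<bar>f w - f v\<bar> \<le> s" if "along i v w" for i v w
  proof -
    have "i \<in> I" using that by (simp add: along_def)
    from C[unfolded universal_colouring_def, rule_format, OF this, of "c i (w i) - c i (v i)" "X v"]
    show "f w \<noteq> f v" "\<bar>f w - f v\<bar> \<le> s"
      using step[OF that] unfolding f_def X_along[OF that] by blast+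
  qed
  \<comment> \<open>Both steps start at the same \<open>x\<close>, so equal increments give equal
    factor colours, although \<open>y i\<close> and \<open>z i\<close> may be different
    vertices.\<close>
  have same: "i = i' \<and> c i (y i) = c i' (z i')"
    if yz: "along i x y" "along i' x z" "f y = f z" for i i' x y z
  proof -
    have i: "i \<in> I" "i' \<in> I" using yz by (simp_all add: along_def)
    have "i = i' \<and> c i (y i) - c i (x i) = c i' (z i') - c i' (x i')"
      using C[unfolded universal_colouring_def, rule_format, OF i(1), of "c i (y i) - c i (x i)" "X x"]
        step[OF yz(1)] step[OF yz(2)] i(2) yz(3) unfolding f_def X_along[OF yz(1)] X_along[OF yz(2)]
      by blast
    thus ?thesis by auto
  qed
  have "free_colouring F ?P f"
  proof (rule free_colouringI[OF F])
    show "colouring ?P f"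
      unfolding colouring_def
    proof (clarify)
      fix v w assume "(v, w) \<in> parcs ?P" "f v = f w"
      moreover from this obtain i where "along i v w" using arc_along by blast
      ultimately show False using neq[of i v w] by simp
    qed
  next
    fix H J
    assume H: "pair_graph H" "subgraph (with_proj H) (with_proj ?P)" "J \<in> F"
      "digraph_iso (with_proj H) (with_proj J)" "Digraph_Component.connected (with_proj H)"
      "3 \<le> card (pverts H)"
      and eq: "\<And>x y z. (x, y) \<in> parcs H \<Longrightarrow> (x, z) \<in> parcs H \<Longrightarrow> f y = f z"
    have sub: "pverts H \<subseteq> pverts ?P" "parcs H \<subseteq> parcs ?P" using H(2) by (auto simp: subgraph_def)
    have "pverts H \<noteq> {}" using H(6) by auto
    then obtain v where v: "v \<in> pverts H" by auto
    then obtain w where vw: "(v, w) \<in> parcs H" using connected_ex_arc[OF H(1,5)] H(6) by force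
    then obtain i where i: "along i v w" using arc_along sub by blast
    \<comment> \<open>The first half places \<open>x\<close> in the fibre through \<open>v\<close>
      in direction \<open>i\<close>; the second half is what carries the first across an
      arc.\<close>
    define Q where "Q = (\<lambda>x. (\<forall>j\<in>I - {i}. x j = v j) \<and> (\<forall>y. (x, y) \<in> parcs H \<longrightarrow> along i x y))"
    have dir: "along i x z" if xyz: "(x, y) \<in> parcs H" "along i x y" "(x, z) \<in> parcs H" for x y z
    proof -
      obtain i' where "along i' x z" using arc_along sub xyz(3) by blast
      with same[OF xyz(2) this eq[OF xyz(1,3)]] show ?thesis by simp
    qed
    have "Q v" using dir[OF vw i] by (simp add: Q_def)
    moreover have "Q y" if xy: "(x, y) \<in> parcs H" "Q x" for x y
    proof -
      have "along i x y" using xy by (simp add: Q_def)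
      with dir[OF pair_graph_sym[OF H(1) xy(1)] along_sym[OF this]] xy(2) show ?thesis
        by (auto simp: Q_def along_def)
    qed
    ultimately have Q: "Q x" if "x \<in> pverts H" for x
      using connected_induct[OF H(1,5) v _ that, of Q] by blast
    have iI: "i \<in> I" using i by (simp add: along_def)
    define p where "p = (\<lambda>x :: 'b \<Rightarrow> 'c. x i)"
    have inj: "inj_on p (pverts H)"
    proof (rule inj_onI)
      fix x y assume xy: "x \<in> pverts H" "y \<in> pverts H" "p x = p y"
      have "x \<in> (\<Pi>\<^sub>E i\<in>I. pverts (G i))" "y \<in> (\<Pi>\<^sub>E i\<in>I. pverts (G i))"
        using xy sub by (auto simp: cartesian_product_simps)
      moreover have "x j = y j" if "j \<in> I" for j
        using Q[OF xy(1)] Q[OF xy(2)] xy(3) that by (cases "j = i") (auto simp: Q_def p_def)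
      ultimately show "x = y" by (rule PiE_ext)
    qed
    \<comment> \<open>Within one fibre the coordinate \<open>i\<close> determines the vertex, so
      projection maps \<open>H\<close> isomorphically onto a subgraph of the factor
      \<open>G i\<close>.\<close>
    define H' where "H' = \<lparr>pverts = p ` pverts H, parcs = map_prod p p ` parcs H\<rparr>"
    have arcs: "(p x, p y) \<in> parcs (G i)" if "(x, y) \<in> parcs H" for x y
      using Q[OF pair_graph_arcD(1)[OF H(1) that]] that by (auto simp: Q_def along_def p_def)
    have H': "pair_graph H'"
    proof (rule pair_graphI)
      show "finite (pverts H')" using pair_graph_finite[OF H(1)] by (simp add: H'_def)
    next
      fix a b assume "(a, b) \<in> parcs H'"
      then obtain x y where xy: "a = p x" "b = p y" "(x, y) \<in> parcs H" by (auto simp: H'_def)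
      note D = pair_graph_arcD[OF H(1) xy(3)]
      show "a \<in> pverts H' \<and> b \<in> pverts H' \<and> a \<noteq> b"
        using D inj_onD[OF inj _ D(1,2)] by (auto simp: H'_def xy)
      have "map_prod p p (y, x) \<in> map_prod p p ` parcs H"
        by (intro imageI pair_graph_sym[OF H(1) xy(3)])
      thus "(b, a) \<in> parcs H'" by (simp add: H'_def xy)
    qed
    have wfH: "wf_digraph (with_proj H)" "wf_digraph (with_proj H')" "wf_digraph (with_proj (G i))"
      using H(1) H' G[OF iI]
      by (simp_all add: wf_digraph_wp_iff pair_graph_def pair_digraph_def pair_fin_digraph_def)
    have "pverts H' \<subseteq> pverts (G i)"
    proof
      fix a assume "a \<in> pverts H'"
      then obtain x where x: "x \<in> pverts H" "a = x i" by (auto simp: H'_def p_def)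
      from x(1) sub(1) have "x \<in> (\<Pi>\<^sub>E i\<in>I. pverts (G i))" by (auto simp: cartesian_product_simps)
      from PiE_mem[OF this iI] show "a \<in> pverts (G i)" by (simp add: x(2))
    qed
    moreover have "parcs H' \<subseteq> parcs (G i)" using arcs by (auto simp: H'_def)
    ultimately have sub': "subgraph (with_proj H') (with_proj (G i))"
      unfolding subgraph_def using wfH by auto
    have "digraph_iso (with_proj H) (with_proj H')"
    proof -
      \<comment> \<open>\<open>iso_head\<close> and \<open>iso_tail\<close> are the head and tail
        functions of the target, where arcs are again pairs.\<close>
      define h where "h = \<lparr>iso_verts = p, iso_arcs = map_prod p p, iso_head = snd, iso_tail = fst\<rparr>"
      have "inj_on (map_prod p p) (parcs H)"
        by (rule inj_on_subset[OF map_prod_inj_on[OF inj inj]]) (auto dest: pair_graph_arcD[OF H(1)])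
      hence "pre_digraph.digraph_isomorphism (with_proj H) h"
        using inj wfH(1) by (auto simp: pre_digraph.digraph_isomorphism_def h_def)
      moreover have "with_proj H' = app_iso h (with_proj H)"
        by (simp add: app_iso_def h_def H'_def with_proj_def)
      ultimately show ?thesis by (auto simp: digraph_iso_def)
    qed
    hence iso: "digraph_iso (with_proj H') (with_proj J)"
      using digraph_iso_swap[OF wfH(1)] H(4) digraph_iso_trans by blast
    note copy = forbidden_copy[OF F H(3) H' iso]
    have "2 \<le> card (pverts H')" using copy(2) by simp
    from free_colouring_tricolour[OF c[OF iI] H' sub' H(3) iso copy(1) this]
    obtain a b b' where abb': "(a, b) \<in> parcs H'" "(a, b') \<in> parcs H'" "c i b \<noteq> c i b'"
      by blast
    then obtain x y x' z where xyz: "(x, y) \<in> parcs H" "(x', z) \<in> parcs H" "a = p x" "a = p x'"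
        "b = p y" "b' = p z"
      by (auto simp: H'_def)
    \<comment> \<open>The two arcs at \<open>a\<close> were lifted separately; injectivity of the
      projection joins their starting points.\<close>
    have "x' = x" using xyz inj pair_graph_arcD(1)[OF H(1)] by (metis inj_onD)
    hence xz: "(x, z) \<in> parcs H" using xyz by simp
    have "along i x y" "along i x z"
      using Q[OF pair_graph_arcD(1)[OF H(1) xz]] xyz(1) xz by (auto simp: Q_def)
    from same[OF this eq[OF xyz(1) xz]] abb'(3) xyz show False by (simp add: p_def)
  qed
  moreover have "colouring_span ?P f \<le> s"
    unfolding colouring_span_le_iff[OF P s]
  proof (clarify)
    fix v w assume "(v, w) \<in> parcs ?P"
    then obtain i where "along i v w" using arc_along by blast
    thus "\<bar>f v - f w\<bar> \<le> s" using le[of i v w] by linarith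
  qed
  ultimately show ?thesis by blast
qed

text \<open>Reduces both bounds to finding one function \<open>C\<close> on integer points; the
  number of colours is controlled through the span.\<close>

lemma free_chromatic_span_cartesian_product:
  assumes F: "forbidden_family F" and I: "finite I"
    and G: "\<And>i. i \<in> I \<Longrightarrow> pair_graph (G i)"
    and span: "\<And>i. i \<in> I \<Longrightarrow> int (free_chromatic_span (G i) F) \<le> k"
    and C: "universal_colouring I k s C" and s: "0 \<le> s"
  shows "int (free_chromatic_span (cartesian_product I G) F) \<le> s"
    and "int (free_chromatic_number (cartesian_product I G) F) \<le> 2 * s + 1"
proof -
  have P: "pair_graph (cartesian_product I G)" by (intro pair_graph_cartesian_product I G)
  have "\<forall>i\<in>I. \<exists>c. free_colouring F (G i) c \<and> colouring_span (G i) c \<le> k"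
    using free_chromatic_span_attained[OF F G] span by metis
  then obtain c where "\<forall>i\<in>I. free_colouring F (G i) (c i) \<and> colouring_span (G i) (c i) \<le> k"
    by metis
  with free_colouring_cartesian_product[where G = G and c = c, OF F I G _ _ C s]
  show *: "int (free_chromatic_span (cartesian_product I G) F) \<le> s"
    using free_chromatic_span_le[OF P] by blast
  show "int (free_chromatic_number (cartesian_product I G) F) \<le> 2 * s + 1"
    using free_chromatic_number_le_span[OF F P] * by linarith
qed

section \<open>Universal colourings from linear forms\<close>

text \<open>The colour encodes a height and a residue modulo \<open>M\<close> as quotient and
  remainder, so equal colours have equal heights and residues. A step \<open>j\<close> along
  \<open>i\<close> adds \<open>(j * h i, j * b i)\<close> to this pair whatever \<open>x\<close> is,
  so it suffices that these vectors are nonzero and distinct. The height contributes at most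
  \<open>M * (k * H)\<close> to the span and the residue at most \<open>M - 1\<close>.\<close>

lemma universal_colouringI_lattice:
  fixes h b :: "'i \<Rightarrow> int"
  assumes I: "finite I" and M: "0 < M"
    and h: "\<And>i. i \<in> I \<Longrightarrow> \<bar>h i\<bar> \<le> H"
    and nz: "\<And>i j. i \<in> I \<Longrightarrow> j \<noteq> 0 \<Longrightarrow> \<bar>j\<bar> \<le> k \<Longrightarrow> j * h i = 0 \<Longrightarrow> M dvd j * b i \<Longrightarrow> False"
    and inj: "\<And>i j i' j'. i \<in> I \<Longrightarrow> i' \<in> I \<Longrightarrow> j \<noteq> 0 \<Longrightarrow> \<bar>j\<bar> \<le> k \<Longrightarrow> j' \<noteq> 0 \<Longrightarrow> \<bar>j'\<bar> \<le> k \<Longrightarrow>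
      j * h i = j' * h i' \<Longrightarrow> M dvd (j * b i - j' * b i') \<Longrightarrow> i = i' \<and> j = j'"
  shows "universal_colouring I k (M * (k * H) + M - 1)
           (\<lambda>x. M * (\<Sum>i\<in>I. h i * x i) + (\<Sum>i\<in>I. b i * x i) mod M)"
    (is "universal_colouring _ _ _ ?C")
proof -
  have upd: "(\<Sum>l\<in>I. a l * (x(i := x i + j)) l) = (\<Sum>l\<in>I. a l * x l) + j * a i"
    if "i \<in> I" for a x :: "'i \<Rightarrow> int" and i j
  proof -
    have "(\<Sum>l\<in>I. a l * (x(i := x i + j)) l) =
        (\<Sum>l\<in>I. a l * x l + (if l = i then j * a i else 0))"
      by (intro sum.cong) (auto simp: algebra_simps)
    thus ?thesis using I that by (simp add: sum.distrib)
  qed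
  have C_upd: "?C (x(i := x i + j)) =
      M * ((\<Sum>l\<in>I. h l * x l) + j * h i) + ((\<Sum>l\<in>I. b l * x l) + j * b i) mod M"
    if "i \<in> I" for x i j
    by (simp only: upd[OF that])
  have split: "u = u' \<and> M dvd (r - r')" if "M * u + r mod M = M * u' + r' mod M" for u r u' r'
  proof -
    have "M * u + r mod M = u * M + r mod M" "M * u' + r' mod M = u' * M + r' mod M" by simp_all
    hence "(M * u + r mod M) div M = u" "(M * u' + r' mod M) div M = u'" using M by simp_all
    with that have "u = u'" by metis
    with that show ?thesis by (simp add: mod_eq_dvd_iff)
  qed
  show ?thesis
    unfolding universal_colouring_def
  proof (intro allI ballI impI conjI; (elim conjE)?)
    fix x i j assume i: "i \<in> I" and j: "j \<noteq> 0" "\<bar>j\<bar> \<le> k"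
    define u where "u = (\<Sum>l\<in>I. h l * x l)"
    define r where "r = (\<Sum>l\<in>I. b l * x l)"
    show "?C (x(i := x i + j)) \<noteq> ?C x"
      using split[of "u + j * h i" "r + j * b i" u r] nz[OF i j] unfolding C_upd[OF i] u_def r_def
      by auto
    have "\<bar>j * h i\<bar> \<le> k * H" using j h[OF i] unfolding abs_mult by (intro mult_mono) auto
    hence "M * \<bar>j * h i\<bar> \<le> M * (k * H)" using M by (intro mult_left_mono) auto
    moreover have "\<bar>M * (j * h i)\<bar> = M * \<bar>j * h i\<bar>" using M by (simp add: abs_mult)
    moreover have "?C (x(i := x i + j)) - ?C x = M * (j * h i) + ((r + j * b i) mod M - r mod M)"
      unfolding C_upd[OF i] u_def r_def by (simp add: algebra_simps)
    moreover have "0 \<le> r mod M" "r mod M < M" "0 \<le> (r + j * b i) mod M" "(r + j * b i) mod M < M"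
      using M by simp_all
    ultimately show "\<bar>?C (x(i := x i + j)) - ?C x\<bar> \<le> M * (k * H) + M - 1" by linarith
    fix i' j' assume i': "i' \<in> I" and j': "j' \<noteq> 0" "\<bar>j'\<bar> \<le> k"
      and eq: "?C (x(i := x i + j)) = ?C (x(i' := x i' + j'))"
    from split[OF eq[unfolded C_upd[OF i] C_upd[OF i']]]
    have "j * h i = j' * h i'" "M dvd (j * b i - j' * b i')" by auto
    from inj[OF i i' j j' this] show "i = i'" "j = j'" by auto
  qed
qed

text \<open>Every \<open>h i\<close> is 1 modulo \<open>k\<close>, so
  \<open>j * h i = j' * h i'\<close> makes \<open>j\<close> and \<open>j'\<close> congruent modulo
  \<open>k\<close>. The largest \<open>h i\<close> is \<open>k * d - k + 1\<close>.\<close>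

lemma universal_colouring_sidon:
  fixes k d :: nat
  assumes k: "1 \<le> k" and d: "1 \<le> d"
  shows "\<exists>C. universal_colouring {1..d} (int k) (int k * (int k * int d - int k + 1)) C"
proof -
  define h :: "nat \<Rightarrow> int" where "h = (\<lambda>i. int k * (int i - 1) + 1)"
  have h_pos: "0 < h i" if "i \<in> {1..d}" for i
    using that k by (simp add: h_def add_nonneg_pos)
  \<comment> \<open>Modulus 1 makes the residue part vanish.\<close>
  have "universal_colouring {1..d} (int k) (1 * (int k * (int k * int d - int k + 1)) + 1 - 1)
          (\<lambda>x. 1 * (\<Sum>i\<in>{1..d}. h i * x i) + (\<Sum>i\<in>{1..d}. 0 * x i) mod 1)"
  proof (rule universal_colouringI_lattice)
    fix i assume i: "i \<in> {1..d}"
    have "int k * (int i - 1) \<le> int k * (int d - 1)" using i by (intro mult_left_mono) auto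
    thus "\<bar>h i\<bar> \<le> int k * int d - int k + 1" using h_pos[OF i] by (simp add: h_def algebra_simps)
  next
    fix i j i' j'
    assume i: "i \<in> {1..d}" "i' \<in> {1..d}"
      and j: "j \<noteq> 0" "\<bar>j\<bar> \<le> int k" "j' \<noteq> 0" "\<bar>j'\<bar> \<le> int k" and eq: "j * h i = j' * h i'"
    have "sgn j = sgn (j * h i)" "sgn j' = sgn (j' * h i')"
      using h_pos[OF i(1)] h_pos[OF i(2)] by (simp_all add: sgn_mult)
    hence sgn: "sgn j = sgn j'" using eq by simp
    have "j - j' = int k * (j' * (int i' - 1) - j * (int i - 1))"
      using eq by (simp add: h_def algebra_simps)
    hence "int k dvd (j - j')" by simp
    \<comment> \<open>Equal signs matter: both absolute values lie between 1 and \<open>k\<close>,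
      so the difference is at most \<open>k - 1\<close>.\<close>
    moreover have "\<bar>j - j'\<bar> < int k" using sgn j by (auto simp: sgn_if split: if_splits)
    ultimately have jj: "j = j'" using dvd_imp_le_int[of "j - j'" "int k"] by fastforce
    hence "h i = h i'" using eq j by simp
    thus "i = i' \<and> j = j'" using jj k by (simp add: h_def)
  qed (use h_pos in force)+
  thus ?thesis by auto
qed

lemma dvd_mult_diff_cancel_nat:
  fixes a b :: nat and j M :: int
  assumes "M dvd j * (int a - int b)" "coprime M j" "\<bar>int a - int b\<bar> < M"
  shows "a = b"
proof -
  have "M dvd (int a - int b)" using assms(1,2) by (simp add: coprime_dvd_mult_right_iff)
  thus ?thesis using dvd_imp_le_int[of "int a - int b" M] assms(3) by linarith
qed

text \<open>With height 1 in every direction, equal heights give \<open>j = j'\<close>. As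
  \<open>j\<close> divides \<open>fact k\<close>, it cancels modulo \<open>M\<close>, and
  \<open>d \<le> M\<close> keeps the indices distinct as residues.\<close>

lemma universal_colouring_mod_coprime:
  fixes k d M :: nat
  assumes M: "0 < M" "d \<le> M" "coprime M (fact k)"
  shows "\<exists>C. universal_colouring {1..d} (int k) (int M * (int k + 1) - 1) C"
proof -
  have "universal_colouring {1..d} (int k) (int M * (int k * 1) + int M - 1)
          (\<lambda>x. int M * (\<Sum>i\<in>{1..d}. 1 * x i) + (\<Sum>i\<in>{1..d}. int i * x i) mod int M)"
  proof (rule universal_colouringI_lattice)
    fix i j i' j'
    assume i: "i \<in> {1..d}" "i' \<in> {1..d}" and j: "j \<noteq> 0" "\<bar>j\<bar> \<le> int k"
      and eq: "j * 1 = j' * 1" "int M dvd j * int i - j' * int i'"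
    have "nat \<bar>j\<bar> dvd fact k" using j by (intro dvd_fact) auto
    hence "coprime M (nat \<bar>j\<bar>)" using M(3) by (meson coprime_divisors dvd_refl)
    hence "coprime (int M) j" by (metis coprime_abs_right_iff coprime_int_iff int_nat_eq abs_ge_zero)
    moreover have "int M dvd j * (int i - int i')" using eq by (simp add: algebra_simps)
    moreover have "\<bar>int i - int i'\<bar> < int M" using i M by auto
    ultimately show "i = i' \<and> j = j'" using dvd_mult_diff_cancel_nat[of "int M" j i i'] eq by simp
  qed (use M in auto)
  thus ?thesis by (auto simp: algebra_simps)
qed

text \<open>Modulo 13 the sets \<open>{t, -t, 2 t, -2 t}\<close> for \<open>t = 1, 3, 4\<close> partition the nonzero residues.\<close>

lemma mod_13_partition:
  fixes j j' t t' :: int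
  assumes "j \<in> {-2, -1, 1, 2}" "j' \<in> {-2, -1, 1, 2}" "t \<in> {1, 3, 4}" "t' \<in> {1, 3, 4}"
    and "13 dvd (j * t - j' * t')"
  shows "j = j' \<and> t = t'"
  using assms by auto

text \<open>Neither the Sidon set of all numbers with even 2-adic valuation nor the choice \<open>h i = 1\<close>, \<open>b i = i\<close>
  gives better than \<open>s \<approx> 3 d\<close> for \<open>k = 2\<close>, whereas \<open>2 e\<^sup>\<gamma> ln 2 \<approx> 2.469\<close>.  With modulus \<open>13 m\<close> there is room for
  \<open>3 m\<close> additional directions of height \<open>h i = 0\<close>, which brings the ratio down to \<open>39 / 16\<close>.\<close>

lemma universal_colouring_two:
  fixes d m :: nat
  assumes m: "odd m" and d: "d \<le> 16 * m"
  shows "\<exists>C. universal_colouring {1..d} 2 (39 * int m - 1) C"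
proof -
  define r :: "nat \<Rightarrow> nat" where "r = (\<lambda>n. if n mod 3 = 0 then 1 else if n mod 3 = 1 then 3 else 4)"
  \<comment> \<open>Up to \<open>13 * m\<close> directions have height 1 and distinct residues
    \<open>i\<close>; at most \<open>3 * m\<close> remain for height 0. Nonzero steps of different
    heights cannot collide.\<close>
  define h :: "nat \<Rightarrow> int" where "h = (\<lambda>i. if i \<le> 13 * m then 1 else 0)"
  define n where "n = (\<lambda>i. i - 1 - 13 * m)"
  \<comment> \<open>The height 0 direction numbered \<open>3 * q + t\<close> gets residue
    \<open>13 * q\<close> plus one of 1, 3, 4. Reduction modulo 13 reveals \<open>j\<close> and
    \<open>t\<close>; then \<open>q\<close> is recovered modulo \<open>m\<close>.\<close>
  define b where "b = (\<lambda>i. if i \<le> 13 * m then i else 13 * (n i div 3) + r (n i))"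
  have m_pos: "0 < m" using m by (rule odd_pos)
  have M: "int (13 * m) = 13 * int m" by simp
  have r: "int (r l) \<in> {1, 3, 4}" for l by (simp add: r_def)
  have r_inj: "l mod 3 = l' mod 3" if "r l = r l'" for l l'
  proof -
    have "l mod 3 < 3" "l' mod 3 < 3" by simp_all
    thus ?thesis using that by (auto simp: r_def split: if_splits)
  qed
  have j_cases: "j \<in> {-2, -1, 1, 2}" if "j \<noteq> 0" "\<bar>j\<bar> \<le> 2" for j :: int
    using that by auto
  \<comment> \<open>Oddness of \<open>m\<close> enters here, for steps of size 2.\<close>
  have cop: "coprime (int m) j" if "j \<in> {-2, -1, 1, 2}" for j :: int
    using that m by auto
  have b_high: "13 dvd (j * int (b i) - j' * int (b i')) \<Longrightarrow> 13 dvd (j * int (r (n i)) - j' * int (r (n i')))"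
    if "\<not> i \<le> 13 * m" "\<not> i' \<le> 13 * m" for i i' j j'
  proof -
    have "j * int (b i) - j' * int (b i') = 13 * (j * int (n i div 3) - j' * int (n i' div 3)) +
        (j * int (r (n i)) - j' * int (r (n i')))"
      using that by (simp add: b_def algebra_simps)
    thus "13 dvd (j * int (b i) - j' * int (b i')) \<Longrightarrow> 13 dvd (j * int (r (n i)) - j' * int (r (n i')))"
      by (metis dvd_add_right_iff dvd_triv_left)
  qed
  have dvd_13: "13 dvd z" if "int (13 * m) dvd z" for z
    using that by (metis M dvd_mult_left)
  have "universal_colouring {1..d} 2 (int (13 * m) * (2 * 1) + int (13 * m) - 1)
          (\<lambda>x. int (13 * m) * (\<Sum>i\<in>{1..d}. h i * x i) + (\<Sum>i\<in>{1..d}. int (b i) * x i) mod int (13 * m))"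
  proof (rule universal_colouringI_lattice)
    fix i and j :: int
    assume j: "j \<noteq> 0" "\<bar>j\<bar> \<le> 2" "j * h i = 0" "int (13 * m) dvd j * int (b i)"
    have i: "\<not> i \<le> 13 * m" using j by (auto simp: h_def)
    have "13 dvd j * int (r (n i))" using b_high[OF i i, of j 0] dvd_13[OF j(4)] by simp
    thus False using j_cases[OF j(1,2)] r[of "n i"] by auto
  next
    fix i i' and j j' :: int
    assume i: "i \<in> {1..d}" "i' \<in> {1..d}" and j: "j \<noteq> 0" "\<bar>j\<bar> \<le> 2" "j' \<noteq> 0" "\<bar>j'\<bar> \<le> 2"
      and eq: "j * h i = j' * h i'" "int (13 * m) dvd j * int (b i) - j' * int (b i')"
    show "i = i' \<and> j = j'"
    proof (cases "i \<le> 13 * m")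
      case True
      hence i': "i' \<le> 13 * m" "j = j'" using eq(1) j by (auto simp: h_def split: if_splits)
      have "coprime (int 13) (int 2)" by (subst coprime_int_iff) (simp add: coprime_iff_gcd_eq_1 gcd_non_0_nat)
      hence "coprime 13 j" using j_cases[OF j(1,2)] by auto
      hence "coprime (int (13 * m)) j" using cop[OF j_cases[OF j(1,2)]] by simp
      moreover have "int (13 * m) dvd j * (int i - int i')"
        using eq(2) True i' by (simp add: b_def algebra_simps)
      moreover have "\<bar>int i - int i'\<bar> < int (13 * m)" using i True i' by auto
      ultimately have "i = i'" using dvd_mult_diff_cancel_nat by blast
      thus ?thesis using i' by simp
    next
      case False
      hence i': "\<not> i' \<le> 13 * m" using eq(1) j by (auto simp: h_def split: if_splits)
      have jr: "j = j' \<and> int (r (n i)) = int (r (n i'))"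
        using mod_13_partition[OF j_cases[OF j(1,2)] j_cases[OF j(3,4)] r r]
          b_high[OF False i' dvd_13[OF eq(2)]] by blast
      \<comment> \<open>With \<open>j\<close> and the representative settled, only the quotients
        remain; they are below \<open>m\<close>, so a congruence modulo \<open>m\<close> determines
        them.\<close>
      hence "13 * int m dvd 13 * (j * (int (n i div 3) - int (n i' div 3)))"
        using eq(2) False i' by (simp add: b_def algebra_simps)
      hence "int m dvd j * (int (n i div 3) - int (n i' div 3))" by simp
      moreover have "n l div 3 < m" if "l \<in> {1..d}" "\<not> l \<le> 13 * m" for l
      proof -
        have "n l < 3 * m" using that d by (auto simp: n_def)
        thus ?thesis by (simp add: less_mult_imp_div_less mult.commute)
      qed
      from this[OF i(1) False] this[OF i(2) i']
      have "\<bar>int (n i div 3) - int (n i' div 3)\<bar> < int m" by linarith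
      ultimately have "n i div 3 = n i' div 3"
        using dvd_mult_diff_cancel_nat cop[OF j_cases[OF j(1,2)]] by blast
      moreover have "n i mod 3 = n i' mod 3" using r_inj[of "n i" "n i'"] jr by simp
      ultimately have "n i = n i'" by (metis div_mult_mod_eq)
      thus ?thesis using jr False i' by (simp add: n_def)
    qed
  qed (use m_pos in \<open>auto simp: h_def\<close>)
  thus ?thesis by (auto simp: algebra_simps)
qed

section \<open>Numerical comparison and asymptotics\<close>

lemma exp_euler_mascheroni_ln_two: "39 / 16 < exp (euler_mascheroni :: real) * 2 * ln 2"
proof -
  have ln2: "69 / 100 \<le> ln (2 :: real)"
    using ln_approx_bounds[of 2 2, simplified, simplified eval_nat_numeral, simplified] by simp
  \<comment> \<open>The margin is thin: about 1.7664 is required, and the quadratic Taylor bound at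
    19/33 itself yields only about 1.741. Squaring the bound at half the argument suffices.\<close>
  have "1767 / 1000 \<le> (1 + 19 / 66 + (19 / 66)\<^sup>2 / 2 :: real) ^ 2"
    by (simp add: power2_eq_square)
  also have "\<dots> \<le> exp (19 / 66) ^ 2"
    by (intro power_mono exp_lower_Taylor_quadratic) auto
  also have "\<dots> = exp (19 / 33 :: real)" by (simp flip: exp_of_nat_mult)
  also have "\<dots> \<le> exp euler_mascheroni" using euler_mascheroni_gt_19_over_33 by simp
  finally have "1767 / 1000 * 2 * (69 / 100) \<le> exp (euler_mascheroni :: real) * 2 * ln 2"
    using ln2 by (intro mult_mono) auto
  thus ?thesis by simp
qed

text \<open>From \<open>k = 3\<close> on, \<open>ln k\<close> is at least 1 and
  \<open>3 / 2 * k\<close> exceeds \<open>k + 1\<close>. At \<open>k = 2\<close> the inequality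
  fails, since 2.469 is below 3.\<close>

lemma exp_euler_mascheroni_ln:
  assumes "3 \<le> (k :: nat)"
  shows "real k + 1 < exp euler_mascheroni * real k * ln (real k)"
proof -
  have "1 + 19 / 33 \<le> exp (19 / 33 :: real)" by (rule exp_ge_add_one_self)
  also have "\<dots> \<le> exp euler_mascheroni" using euler_mascheroni_gt_19_over_33 by simp
  finally have e: "3 / 2 \<le> exp (euler_mascheroni :: real)" by simp
  have "exp 1 \<le> real k" using exp_le assms by linarith
  hence "1 \<le> ln (real k)" using assms by (subst ln_ge_iff) auto
  hence "3 / 2 * real k * 1 \<le> exp euler_mascheroni * real k * ln (real k)"
    using e by (intro mult_mono) auto
  thus ?thesis using assms by linarith
qed

text \<open>A strict gap between the slopes absorbs the additive cost of rounding \<open>d\<close>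
  up to an admissible modulus.\<close>

lemma linear_eventually_le:
  fixes a b c :: real
  assumes "a < b"
  shows "\<exists>n\<^sub>0 :: nat. \<forall>n>n\<^sub>0. a * real n + c \<le> b * real n"
proof (intro exI allI impI)
  fix n :: nat assume "nat \<lceil>c / (b - a)\<rceil> < n"
  hence "c / (b - a) \<le> real n" by linarith
  thus "a * real n + c \<le> b * real n" using assms by (simp add: field_simps)
qed

lemma universal_colouring_asymptotic:
  fixes k :: nat
  assumes k: "2 \<le> k"
  shows "\<exists>d\<^sub>0 :: nat. \<forall>d>d\<^sub>0. \<exists>s C. universal_colouring {1..d} (int k) s C \<and> 0 \<le> s \<and>
           real_of_int s \<le> exp euler_mascheroni * real d * real k * ln (real k)"
proof (cases "k = 2")
  case True
  \<comment> \<open>The constant is \<open>39 / 16 * 48\<close>, where 48 bounds the excess of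
    \<open>16 * m\<close> over \<open>d\<close> below.\<close>
  obtain d\<^sub>0 where d\<^sub>0: "\<And>d. d\<^sub>0 < d \<Longrightarrow> 39 / 16 * real d + 117 \<le> exp euler_mascheroni * 2 * ln 2 * real d"
    using linear_eventually_le[OF exp_euler_mascheroni_ln_two, of 117] by blast
  have "\<exists>s C. universal_colouring {1..d} (int k) s C \<and> 0 \<le> s \<and>
      real_of_int s \<le> exp euler_mascheroni * real d * real k * ln (real k)" if d: "d\<^sub>0 < d" for d
  proof -
    define m where "m = 2 * (d div 32) + 3"
    have m: "odd m" "d \<le> 16 * m" "16 * m \<le> d + 48" by (auto simp: m_def)
    have "real_of_int (39 * int m - 1) \<le> 39 / 16 * real d + 117" using m(3) by linarith
    also note d\<^sub>0[OF d]
    finally have "real_of_int (39 * int m - 1) \<le> exp euler_mascheroni * real d * real k * ln (real k)"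
      using True by (simp add: algebra_simps)
    moreover have "0 \<le> 39 * int m - 1" by (simp add: m_def)
    ultimately show ?thesis using universal_colouring_two[OF m(1,2)] True by fastforce
  qed
  thus ?thesis by blast
next
  case False
  hence k3: "3 \<le> k" using k by simp
  obtain d\<^sub>0 where d\<^sub>0: "\<And>d. d\<^sub>0 < d \<Longrightarrow> (real k + 1) * real d + (real k + 1) * (fact k + 1)
      \<le> exp euler_mascheroni * real k * ln (real k) * real d"
    using linear_eventually_le[OF exp_euler_mascheroni_ln[OF k3]] by blast
  have "\<exists>s C. universal_colouring {1..d} (int k) s C \<and> 0 \<le> s \<and>
      real_of_int s \<le> exp euler_mascheroni * real d * real k * ln (real k)" if d: "d\<^sub>0 < d" for d
  proof -
    \<comment> \<open>One more than a multiple of \<open>fact k\<close> is coprime to it; the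
      multiple taken is the first one above \<open>d\<close>.\<close>
    define M :: nat where "M = fact k * (d div fact k + 1) + 1"
    have "d = fact k * (d div fact k) + d mod fact k" "d mod fact k < fact k" by simp_all
    hence M: "0 < M" "d \<le> M" "M \<le> d + fact k + 1" unfolding M_def distrib_left by linarith+
    have "coprime M (fact k)" unfolding M_def by (metis coprime_Suc_right_nat Suc_eq_plus1 coprime_commute coprime_mult_left_iff)
    from universal_colouring_mod_coprime[OF M(1,2) this]
    obtain C where C: "universal_colouring {1..d} (int k) (int M * (int k + 1) - 1) C" by blast
    have "real M \<le> real (d + fact k + 1)" using M(3) by (simp only: of_nat_le_iff)
    hence "real M * (real k + 1) \<le> (real d + fact k + 1) * (real k + 1)"
      by (intro mult_right_mono) auto
    also have "\<dots> \<le> exp euler_mascheroni * real k * ln (real k) * real d"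
      using d\<^sub>0[OF d] by (simp add: algebra_simps)
    finally have "real_of_int (int M * (int k + 1) - 1) \<le>
        exp euler_mascheroni * real d * real k * ln (real k)"
      by (simp add: algebra_simps)
    moreover have "1 * 1 \<le> int M * (int k + 1)" using M(1) by (intro mult_mono) auto
    ultimately show ?thesis using C by (intro exI conjI) auto
  qed
  thus ?thesis by blast
qed

section \<open>Combination of the constructions into the four bounds\<close>

text \<open>The asymptotic part takes \<open>\<epsilon> < 1\<close> to keep the denominator positive
  and \<open>2 \<le> k\<close> because \<open>ln 1 = 0\<close> would admit only edgeless
  products.\<close>

theorem theorem2:
  "\<exists>d\<^sub>0 :: nat \<Rightarrow> real \<Rightarrow> nat.
     \<forall>(F :: 'b pair_pre_digraph set) (k :: nat) (d :: nat) (G :: nat \<Rightarrow> 'a pair_pre_digraph).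
       forbidden_family F \<longrightarrow> 1 \<le> k \<longrightarrow> 1 \<le> d \<longrightarrow> (\<forall>i\<in>{1..d}. pair_graph (G i)) \<longrightarrow>
       (\<forall>i\<in>{1..d}. free_chromatic_number (G i) F \<le> k + 1 \<longrightarrow> free_chromatic_span (G i) F \<le> k) \<and>
       ((\<forall>i\<in>{1..d}. free_chromatic_span (G i) F \<le> k) \<longrightarrow>
          int (free_chromatic_span (cartesian_product {1..d} G) F)
            \<le> int k * (int k * int d - int k + 1) \<and>
          int (free_chromatic_number (cartesian_product {1..d} G) F)
            \<le> 2 * int k * (int k * int d - int k + 1) + 1 \<and>
          (\<forall>\<epsilon> :: real. 0 < \<epsilon> \<and> \<epsilon> < 1 \<and> 2 \<le> k \<and> d\<^sub>0 k \<epsilon> < d \<longrightarrow>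
             real (free_chromatic_span (cartesian_product {1..d} G) F)
               \<le> exp euler_mascheroni / (1 - \<epsilon>) * real d * real k * ln (real k) \<and>
             real (free_chromatic_number (cartesian_product {1..d} G) F)
               \<le> 1 + 2 * exp euler_mascheroni / (1 - \<epsilon>) * real d * real k * ln (real k)))"
proof -
  have "\<exists>d\<^sub>0 :: nat \<Rightarrow> nat. \<forall>k\<ge>2. \<forall>d>d\<^sub>0 k. \<exists>s C. universal_colouring {1..d} (int k) s C \<and> 0 \<le> s \<and>
           real_of_int s \<le> exp euler_mascheroni * real d * real k * ln (real k)"
    using universal_colouring_asymptotic by metis
  then obtain d\<^sub>0 :: "nat \<Rightarrow> nat" where d\<^sub>0: "\<And>k d. 2 \<le> k \<Longrightarrow> d\<^sub>0 k < d \<Longrightarrow>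
      \<exists>s C. universal_colouring {1..d} (int k) s C \<and> 0 \<le> s \<and>
           real_of_int s \<le> exp euler_mascheroni * real d * real k * ln (real k)"
    by metis
  show ?thesis
  \<comment> \<open>The threshold is constant in \<open>\<epsilon>\<close>: beyond it the bound
    holds with the bare factor \<open>exp euler_mascheroni\<close>, and dividing by
    \<open>1 - \<epsilon>\<close> enlarges the right side.\<close>
  proof (rule exI[of _ "\<lambda>k \<epsilon>. d\<^sub>0 k"], intro allI impI conjI ballI; (elim conjE)?)
    fix F :: "'b pair_pre_digraph set" and k d :: nat and G :: "nat \<Rightarrow> 'a pair_pre_digraph"
    assume F: "forbidden_family F" and k: "1 \<le> k" and d: "1 \<le> d"
      and G: "\<forall>i\<in>{1..d}. pair_graph (G i)"
    show "free_chromatic_span (G i) F \<le> k"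
      if "i \<in> {1..d}" "free_chromatic_number (G i) F \<le> k + 1" for i
      using free_chromatic_span_le_number[OF F] G that by blast
    let ?P = "cartesian_product {1..d} G"
    assume span: "\<forall>i\<in>{1..d}. free_chromatic_span (G i) F \<le> k"
    have le: "int (free_chromatic_span ?P F) \<le> s"
      "int (free_chromatic_number ?P F) \<le> 2 * s + 1"
      if "universal_colouring {1..d} (int k) s C" "0 \<le> s" for s C
      using free_chromatic_span_cartesian_product[OF F _ _ _ that, of G] G span by auto
    obtain C where C: "universal_colouring {1..d} (int k) (int k * (int k * int d - int k + 1)) C"
      using universal_colouring_sidon[OF k d] by blast
    have "int k * 1 \<le> int k * int d" using d by (intro mult_left_mono) auto
    hence "0 \<le> int k * (int k * int d - int k + 1)" by (intro mult_nonneg_nonneg) auto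
    from le[OF C this]
    show "int (free_chromatic_span ?P F) \<le> int k * (int k * int d - int k + 1)"
      "int (free_chromatic_number ?P F) \<le> 2 * int k * (int k * int d - int k + 1) + 1"
      by (simp_all only: mult.assoc)
    fix \<epsilon> :: real
    assume \<epsilon>: "0 < \<epsilon>" "\<epsilon> < 1" and k2: "2 \<le> k" and large: "d\<^sub>0 k < d"
    obtain s C where sC: "universal_colouring {1..d} (int k) s C" "0 \<le> s"
      and s: "real_of_int s \<le> exp euler_mascheroni * real d * real k * ln (real k)"
      using d\<^sub>0[OF k2 large] by blast
    define A where "A = exp euler_mascheroni * real d * real k * ln (real k)"
    have "0 \<le> A" using k2 by (simp add: A_def)
    hence "A * (1 - \<epsilon>) \<le> A * 1" using \<epsilon> by (intro mult_left_mono) auto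
    hence "A \<le> A / (1 - \<epsilon>)" using \<epsilon> by (simp add: field_simps)
    hence bound: "real_of_int s \<le> exp euler_mascheroni / (1 - \<epsilon>) * real d * real k * ln (real k)"
      using s by (simp add: A_def)
    show "real (free_chromatic_span ?P F)
        \<le> exp euler_mascheroni / (1 - \<epsilon>) * real d * real k * ln (real k)"
      using le(1)[OF sC] bound by linarith
    show "real (free_chromatic_number ?P F)
        \<le> 1 + 2 * exp euler_mascheroni / (1 - \<epsilon>) * real d * real k * ln (real k)"
      using le(2)[OF sC] bound by simp
  qed
qed

end
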